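(* Let $U,V$ be linear subspaces of $\mathbb{R}^n$, let $x\in\mathbb{R}^n$, $y=R_U(x)$, $z=R_VR_U(x)$, and $W^x=\operatorname{aff}\{x,y,z\}$. Then $$P_{W^x}(w)=C_T(x)\qquad\text{for all } w\in U\cap V.$$ In particular, $P_{W^x}(P_{U\cap V}(x))=C_T(x)$.
   Context: $\mathbb{R}^n$ carries the Euclidean inner product and norm. For a nonempty closed convex set $S\subset\mathbb{R}^n$, $P_S$ is the orthogonal projection onto $S$ and $R_S=2P_S-\mathrm{Id}$ is the reflection. $\operatorname{aff}$ denotes the affine hull. $C_T(x)$ is the circumcenter of $\{x,y,z\}$, i.e. the unique point of $\operatorname{aff}\{x,y,z\}$ that is equidistant to $x$, $y$ and $z$ (it exists and is unique for every $x$; if $x,y,z$ all coincide it is $x$, and if $\{x,y,z\}$ has exactly two elements it is their midpoint). *)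

theory Defs
  imports "HOL-Analysis.Analysis"
begin

text \<open>
  The orthogonal projection \<open>P\<^sub>S\<close> onto a nonempty closed convex set \<open>S\<close> is \<open>closest_point S\<close>.
\<close>

definition reflect_in :: "'a::euclidean_space set \<Rightarrow> 'a \<Rightarrow> 'a"
  where "reflect_in S x = 2 *\<^sub>R closest_point S x - x"

text \<open>
  The description is proper only when an equidistant point exists in the affine hull; this fails
  for three distinct collinear points. There is never more than one such point.
\<close>

definition circumcenter :: "'a::euclidean_space \<Rightarrow> 'a \<Rightarrow> 'a \<Rightarrow> 'a"
  where "circumcenter x y z =
    (THE p. p \<in> affine hull {x, y, z} \<and> dist p x = dist p y \<and> dist p y = dist p z)"

text \<open>
  The operator \<open>C\<^sub>T\<close>. For linear subspaces \<open>U\<close> and \<open>V\<close> the three points below are never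
  distinct and collinear, as they lie on a common sphere centred at the origin.
\<close>

definition circumcentered_reflection ::
    "'a::euclidean_space set \<Rightarrow> 'a set \<Rightarrow> 'a \<Rightarrow> 'a"
  where "circumcentered_reflection U V x =
    circumcenter x (reflect_in U x) (reflect_in V (reflect_in U x))"

end

theory Submission
  imports Defs
begin

text \<open>
  A point \<open>w\<close> of \<open>U \<inter> V\<close> is fixed by both reflections, and a reflection in a subspace preserves
  distances to the points of that subspace; hence \<open>w\<close> has equal distances to \<open>x\<close>, \<open>y\<close> and \<open>z\<close>.
  By Pythagoras, projecting \<open>w\<close> orthogonally onto \<open>W = aff {x, y, z}\<close> lowers the squared
  distance to every point of \<open>W\<close> by the same amount, so the projection is still equidistant to
  \<open>x\<close>, \<open>y\<close> and \<open>z\<close> (\<open>closest_point_affine_hull_equidistant\<close>). It also lies in \<open>W\<close>, and such a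
  point is unique (\<open>equidistant_in_affine_hull_unique\<close>), so it is the circumcenter.
  In particular the circumcenter exists for these three points, and the statement about
  \<open>P\<^bsub>U \<inter> V\<^esub> x\<close> is the case \<open>w = P\<^bsub>U \<inter> V\<^esub> x\<close>.
\<close>

text \<open>
  In a closed convex set the angle between \<open>x - p\<close> and \<open>a - p\<close> at the point \<open>p\<close> closest to \<open>x\<close>
  is never acute.
  An affine set contains with \<open>a\<close> also its mirror image in \<open>p\<close>, which forces a right angle.
\<close>

lemma closest_point_affine_orthogonal:
  fixes S :: "'a::euclidean_space set"
  assumes "affine S" and "a \<in> S"
  shows "(x - closest_point S x) \<bullet> (a - closest_point S x) = 0"
proof -
  let ?p = "closest_point S x"
  have S: "convex S" "closed S"
    using assms(1) by (auto intro: affine_imp_convex affine_closed)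
  have p: "?p \<in> S"
    using S assms(2) by (auto intro: closest_point_in_set)
  have "2 *\<^sub>R ?p + (-1) *\<^sub>R a \<in> S"
    using assms p by (intro mem_affine) auto
  then have "(x - ?p) \<bullet> (2 *\<^sub>R ?p + (-1) *\<^sub>R a - ?p) \<le> 0"
    by (rule closest_point_dot[OF S])
  moreover have "2 *\<^sub>R ?p + (-1) *\<^sub>R a - ?p = - (a - ?p)"
    by (simp add: scaleR_2)
  ultimately have "- ((x - ?p) \<bullet> (a - ?p)) \<le> 0"
    by (metis inner_minus_right)
  with closest_point_dot[OF S assms(2), of x] show ?thesis
    by linarith
qed

lemma dist_closest_point_affine_Pythagoras:
  fixes S :: "'a::euclidean_space set"
  assumes "affine S" and "a \<in> S"
  shows "(dist x a)\<^sup>2 = (dist x (closest_point S x))\<^sup>2 + (dist (closest_point S x) a)\<^sup>2"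
  using closest_point_affine_orthogonal[OF assms, of x]
  by (simp add: dist_norm power2_norm_eq_inner inner_diff inner_commute)

lemma dist_reflect_in:
  fixes S :: "'a::euclidean_space set"
  assumes "affine S" and "w \<in> S"
  shows "dist w (reflect_in S x) = dist w x"
proof -
  have "(dist w (reflect_in S x))\<^sup>2 = (dist w x)\<^sup>2"
    using closest_point_affine_orthogonal[OF assms, of x]
    by (simp add: reflect_in_def dist_norm power2_norm_eq_inner inner_diff inner_commute
        algebra_simps)
  then show ?thesis
    by simp
qed

lemma closest_point_affine_hull_equidistant:
  fixes A :: "'a::euclidean_space set"
  assumes "a \<in> A" "b \<in> A" and "dist w a = dist w b"
  shows "dist (closest_point (affine hull A) w) a = dist (closest_point (affine hull A) w) b"
proof -
  let ?p = "closest_point (affine hull A) w"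
  have "(dist ?p a)\<^sup>2 = (dist ?p b)\<^sup>2"
    using dist_closest_point_affine_Pythagoras[of "affine hull A" a w]
      dist_closest_point_affine_Pythagoras[of "affine hull A" b w] assms
    by (simp add: affine_affine_hull hull_inc)
  then show ?thesis
    by simp
qed

text \<open>
  The squared distances from \<open>a\<close> to \<open>p\<close> and to \<open>q\<close> differ by an affine function of \<open>a\<close>,
  because the quadratic terms cancel; its linear part is \<open>-2 (p - q) \<bullet> a\<close>. It is constant
  on \<open>A\<close>, hence on the affine hull of \<open>A\<close>, hence agrees at \<open>p\<close> and at \<open>q\<close>; so \<open>p - q\<close> is
  orthogonal to itself.
\<close>

lemma equidistant_in_affine_hull_unique:
  fixes A :: "'a::euclidean_space set"
  assumes "p \<in> affine hull A" "q \<in> affine hull A"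
    and p: "\<And>a. a \<in> A \<Longrightarrow> dist p a = r"
    and q: "\<And>a. a \<in> A \<Longrightarrow> dist q a = s"
  shows "p = q"
proof -
  \<comment> \<open>The level follows from expanding \<open>r\<^sup>2 = (dist p a)\<^sup>2\<close> and \<open>s\<^sup>2 = (dist q a)\<^sup>2\<close> and subtracting.\<close>
  let ?H = "{a. (p - q) \<bullet> a = (p \<bullet> p - q \<bullet> q - r\<^sup>2 + s\<^sup>2) / 2}"
  have "A \<subseteq> ?H"
  proof
    fix a
    assume "a \<in> A"
    then have "(dist p a)\<^sup>2 = r\<^sup>2" "(dist q a)\<^sup>2 = s\<^sup>2"
      using p q by simp_all
    then show "a \<in> ?H"
      by (simp add: dist_norm power2_norm_eq_inner inner_diff inner_commute field_simps)
  qed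
  then have "affine hull A \<subseteq> ?H"
    by (rule hull_minimal) (rule affine_hyperplane)
  then have "(p - q) \<bullet> p = (p - q) \<bullet> q"
    using assms(1,2) by (metis (mono_tags, lifting) mem_Collect_eq subsetD)
  then have "(p - q) \<bullet> (p - q) = 0"
    by (simp add: inner_diff_right)
  then show ?thesis
    by simp
qed

lemma circumcenter_eqI:
  assumes "p \<in> affine hull {x, y, z}" "dist p x = dist p y" "dist p y = dist p z"
  shows "circumcenter x y z = p"
  unfolding circumcenter_def
proof (rule the_equality)
  fix q
  assume q: "q \<in> affine hull {x, y, z} \<and> dist q x = dist q y \<and> dist q y = dist q z"
  show "q = p"
    by (rule equidistant_in_affine_hull_unique[where A = "{x, y, z}" and r = "dist q x"
          and s = "dist p x"]) (use q assms in auto)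
qed (use assms in simp)

lemma closest_point_affine_hull_eq_circumcenter:
  fixes w x y z :: "'a::euclidean_space"
  assumes "dist w x = dist w y" "dist w y = dist w z"
  shows "closest_point (affine hull {x, y, z}) w = circumcenter x y z"
proof (rule circumcenter_eqI[symmetric])
  show "closest_point (affine hull {x, y, z}) w \<in> affine hull {x, y, z}"
    by (rule closest_point_in_set) auto
qed (use assms in \<open>auto intro: closest_point_affine_hull_equidistant\<close>)

theorem lemma2p3:
  fixes U V W :: "(real ^ 'n) set" and x y z :: "real ^ 'n"
  assumes "subspace U" and "subspace V"
    and "y = reflect_in U x"
    and "z = reflect_in V (reflect_in U x)"
    and "W = affine hull {x, y, z}"
  shows "(\<forall>w \<in> U \<inter> V. closest_point W w = circumcentered_reflection U V x)
    \<and> closest_point W (closest_point (U \<inter> V) x) = circumcentered_reflection U V x"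
proof -
  have main: "closest_point W w = circumcentered_reflection U V x" if "w \<in> U \<inter> V" for w
  proof -
    have "dist w x = dist w y" "dist w y = dist w z"
      using that assms by (simp_all add: dist_reflect_in subspace_imp_affine)
    then show ?thesis
      using assms(3-5)
      by (simp add: circumcentered_reflection_def closest_point_affine_hull_eq_circumcenter)
  qed
  have "subspace (U \<inter> V)"
    using assms(1,2) by (rule subspace_inter)
  then have "closest_point (U \<inter> V) x \<in> U \<inter> V"
    by (intro closest_point_in_set) (auto simp: closed_subspace dest: subspace_0)
  then show ?thesis
    using main by blast
qed

end
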